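(* Let $A$ be a fixed integer-valued matrix of dimension $\ell\times k$ and $b$ a fixed integer-valued vector of dimension $\ell$, such that the pair $(A,b)$ is irredundant and $A$ is irredundant and does not satisfy $( * )$. Then: \begin{itemize} \item[(i)] If $A=\begin{pmatrix}\alpha & -\beta\end{pmatrix}$ where $\alpha,\beta$ are non-equal positive integers, then Maker wins the $(A,b)$-game on $[n]_p$ w.h.p. if $p\gg n^{-1/3}$. \item[(ii)] Breaker wins the $(A,b)$-game on $[n]_p$ w.h.p. if $p\ll n^{-1/3}$. \item[(iii)] If $A=\begin{pmatrix}\alpha&-\beta&0\\0&\alpha&-\beta\end{pmatrix}$ where $\alpha,\beta$ are non-equal positive integers, then Breaker wins the $(A,0)$-game on $[n]$; consequently, with probability one Breaker wins the $(A,0)$-game on $[n]_p$ for any $0<p<1$. \end{itemize}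
   Context: A solution $x=(x_1,\dots,x_k)$ to $Ax=b$ is $k$-distinct if the $x_i$ are pairwise distinct. $(A,b)$ is irredundant if $Ax=b$ has a $k$-distinct solution in $\mathbb{N}$; $A$ is irredundant if $(A,0)$ is. $A$ satisfies $( * )$ if under Gaussian elimination $A$ does not have any row which consists of precisely two non-zero rational entries. For a set of integers $X$, the $(A,b)$-game on $X$: Maker and Breaker alternately claim previously unclaimed elements of $X$ (Maker first); Maker wins if her claimed set contains all entries of some $k$-distinct solution to $Ax=b$, otherwise Breaker wins. $[n]_p$ is the random subset of $[n]=\{1,\dots,n\}$ with each element included independently with probability $p=p(n)$. W.h.p. means with probability tending to $1$ as $n\to\infty$; $p\gg f$ means $p/f\to\infty$, $p\ll f$ means $p/f\to0$. *)

theory Defs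
  imports
    "HOL-Probability.Product_PMF"
    "Jordan_Normal_Form.Gauss_Jordan_Elimination"
begin

definition k_distinct_solution :: "int mat \<Rightarrow> int Matrix.vec \<Rightarrow> int Matrix.vec \<Rightarrow> bool" where
  "k_distinct_solution A b x \<longleftrightarrow>
     x \<in> carrier_vec (dim_col A) \<and> A *\<^sub>v x = b \<and> inj_on (vec_index x) {..<dim_col A}"

text \<open>As for \<open>[n] = {1,\<dots>,n}\<close>, the natural numbers start at 1.\<close>

definition irredundant_pair :: "int mat \<Rightarrow> int Matrix.vec \<Rightarrow> bool" where
  "irredundant_pair A b \<longleftrightarrow> (\<exists>x. k_distinct_solution A b x \<and> set\<^sub>v x \<subseteq> {1..})"

definition irredundant :: "int mat \<Rightarrow> bool" where
  "irredundant A \<longleftrightarrow> irredundant_pair A (0\<^sub>v (dim_row A))"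

inductive row_op :: "'a::field mat \<Rightarrow> 'a mat \<Rightarrow> bool" where
  swap: "i < dim_row A \<Longrightarrow> j < dim_row A \<Longrightarrow> row_op A (swaprows i j A)"
| scale: "i < dim_row A \<Longrightarrow> c \<noteq> 0 \<Longrightarrow> row_op A (multrow i c A)"
| add: "i < dim_row A \<Longrightarrow> j < dim_row A \<Longrightarrow> i \<noteq> j \<Longrightarrow> row_op A (addrow c i j A)"

text \<open>The condition \<open>(*)\<close> refers to every matrix obtainable from \<open>A\<close> by elementary row operations
  over the rationals, not just to the reduced echelon form, which depends on the order of the
  columns: the latter may have no row with exactly two non-zero entries although some
  row-equivalent matrix has one, as for the rows \<open>(1,0,-2,-2)\<close> and \<open>(0,1,-1,-1)\<close>.\<close>

definition satisfies_star :: "int mat \<Rightarrow> bool" where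
  "satisfies_star A \<longleftrightarrow>
     (\<forall>B. row_op\<^sup>*\<^sup>* (map_mat rat_of_int A) B \<longrightarrow>
        \<not> (\<exists>i<dim_row B. card {j. j < dim_col B \<and> B $$ (i, j) \<noteq> 0} = 2))"

text \<open>All boards are finite. A history is the list of the moves made so far by both players; Maker
  makes the moves with even index, Breaker those with odd index. The game goes on until the
  whole board is claimed.\<close>

definition strategy_on :: "int set \<Rightarrow> (int list \<Rightarrow> int) \<Rightarrow> bool" where
  "strategy_on X s \<longleftrightarrow> (\<forall>h. distinct h \<and> set h \<subset> X \<longrightarrow> s h \<in> X - set h)"

definition complete_play :: "int set \<Rightarrow> int list \<Rightarrow> bool" where
  "complete_play X h \<longleftrightarrow> distinct h \<and> set h = X"

definition maker_follows :: "(int list \<Rightarrow> int) \<Rightarrow> int list \<Rightarrow> bool" where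
  "maker_follows s h \<longleftrightarrow> (\<forall>i<length h. even i \<longrightarrow> h ! i = s (take i h))"

definition breaker_follows :: "(int list \<Rightarrow> int) \<Rightarrow> int list \<Rightarrow> bool" where
  "breaker_follows s h \<longleftrightarrow> (\<forall>i<length h. odd i \<longrightarrow> h ! i = s (take i h))"

definition maker_claimed :: "int list \<Rightarrow> int set" where
  "maker_claimed h = {h ! i | i. i < length h \<and> even i}"

definition contains_solution :: "int mat \<Rightarrow> int Matrix.vec \<Rightarrow> int set \<Rightarrow> bool" where
  "contains_solution A b M \<longleftrightarrow> (\<exists>x. k_distinct_solution A b x \<and> set\<^sub>v x \<subseteq> M)"

definition maker_wins :: "int mat \<Rightarrow> int Matrix.vec \<Rightarrow> int set \<Rightarrow> bool" where
  "maker_wins A b X \<longleftrightarrow>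
     (\<exists>s. strategy_on X s \<and>
        (\<forall>h. complete_play X h \<and> maker_follows s h \<longrightarrow> contains_solution A b (maker_claimed h)))"

definition breaker_wins :: "int mat \<Rightarrow> int Matrix.vec \<Rightarrow> int set \<Rightarrow> bool" where
  "breaker_wins A b X \<longleftrightarrow>
     (\<exists>s. strategy_on X s \<and>
        (\<forall>h. complete_play X h \<and> breaker_follows s h \<longrightarrow> \<not> contains_solution A b (maker_claimed h)))"

definition random_set :: "nat \<Rightarrow> real \<Rightarrow> int set pmf" where
  "random_set n p =
     map_pmf (\<lambda>f. {i \<in> {1..int n}. f i}) (Pi_pmf {1..int n} False (\<lambda>_. bernoulli_pmf p))"

definition whp :: "(nat \<Rightarrow> real) \<Rightarrow> (int set \<Rightarrow> bool) \<Rightarrow> bool" where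
  "whp p Q \<longleftrightarrow> (\<lambda>n. measure_pmf.prob (random_set n (p n)) {X. Q X}) \<longlonglongrightarrow> 1"

definition much_greater :: "(nat \<Rightarrow> real) \<Rightarrow> (nat \<Rightarrow> real) \<Rightarrow> bool" (infix \<open>\<ggreater>\<close> 50) where
  "p \<ggreater> f \<longleftrightarrow> filterlim (\<lambda>n. p n / f n) at_top sequentially"

definition much_less :: "(nat \<Rightarrow> real) \<Rightarrow> (nat \<Rightarrow> real) \<Rightarrow> bool" (infix \<open>\<lless>\<close> 50) where
  "p \<lless> f \<longleftrightarrow> (\<lambda>n. p n / f n) \<longlonglongrightarrow> 0"

end

theory Submission
  imports Defs "HOL-Number_Theory.Cong"
begin

text \<open>
  If \<open>A\<close> fails \<open>(*)\<close>, every solution contains two distinct entries \<open>u, v\<close> with \<open>r u + s v = c\<close> for fixed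
  non-zero \<open>r, s\<close>. Such pairs are the edges of a graph in which every integer has at most one
  successor and at most one predecessor, so \<open>[n]\<close> contains at most \<open>n\<close> paths on three vertices.
  For \<open>n p\<^sup>3 \<rightarrow> 0\<close> a union bound shows that \<open>[n]\<^sub>p\<close> contains none of them w.h.p.; then its edges are
  pairwise disjoint and Breaker answers each move of Maker with the neighbour of the claimed number.
  For the equation \<open>\<alpha> u - \<beta> v = c\<close>, conversely, \<open>[n]\<close> contains linearly many pairwise disjoint such
  paths, so \<open>[n]\<^sub>p\<close> contains one w.h.p. once \<open>n p\<^sup>3 \<rightarrow> \<infinity>\<close>; Maker wins by claiming its middle vertex
  and then one of the two ends. For the third part, the edges \<open>\<alpha> u = \<beta> v\<close> whose initial vertex \<open>u\<close>
  has even position on its path form a matching that meets every path on three vertices in an edge,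
  and Breaker plays by pairing along this matching.
\<close>

section \<open>Strategies for Breaker and for Maker\<close>

text \<open>Breaker answers each number with its partner if that is still free, and arbitrarily
  otherwise. If Maker got both members of a pair, the later one was still free right after she
  claimed the earlier one, so Breaker took it. Symmetry of \<open>P\<close> covers both orders of
  claiming.\<close>

lemma pairing_strategy:
  assumes sym: "\<And>x y. P x y \<Longrightarrow> P y x"
    and partner_unique: "\<And>x y z. x \<in> X \<Longrightarrow> y \<in> X \<Longrightarrow> z \<in> X \<Longrightarrow> P x y \<Longrightarrow> P x z \<Longrightarrow> y = z"
  obtains s where "strategy_on X s"
    and "\<And>h x y. complete_play X h \<Longrightarrow> breaker_follows s h \<Longrightarrow>
      x \<in> maker_claimed h \<Longrightarrow> y \<in> maker_claimed h \<Longrightarrow> P x y \<Longrightarrow> x = y"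
proof -
  \<comment> \<open>\<open>last h\<close> is Maker's most recent move. On the empty history its
    value is unspecified, but both branches return a free number whenever one exists, so
    \<open>s\<close> is legal there too.\<close>
  define s where "s h = (if \<exists>y\<in>X - set h. P (last h) y
    then SOME y. y \<in> X - set h \<and> P (last h) y else SOME y. y \<in> X - set h)" for h
  have s_partner: "s h \<in> X - set h \<and> P (last h) (s h)" if "\<exists>y\<in>X - set h. P (last h) y" for h
  proof -
    from that have "\<exists>y. y \<in> X - set h \<and> P (last h) y" by blast
    from someI_ex[OF this] show ?thesis using that by (simp add: s_def)
  qed
  have "s h \<in> X - set h" if "set h \<subset> X" for h
  proof (cases "\<exists>y\<in>X - set h. P (last h) y")
    case True
    then show ?thesis using s_partner by blast
  next
    case False
    moreover have "\<exists>y. y \<in> X - set h" using that by blast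
    ultimately show ?thesis using someI_ex[of "\<lambda>y. y \<in> X - set h"] by (simp add: s_def)
  qed
  then have strat: "strategy_on X s"
    by (simp add: strategy_on_def)
  have no_pair: False
    if h: "complete_play X h" "breaker_follows s h" and ij: "i < j" "j < length h" "even i" "even j"
      and P: "P (h ! i) (h ! j)" for h i j
  proof -
    \<comment> \<open>Both indices are even, so Breaker's reply at \<open>Suc i\<close> comes
      strictly before move \<open>j\<close>.\<close>
    have ij': "Suc i < j" using ij by (metis Suc_lessI even_Suc)
    have dist: "distinct h" and X: "set h = X" using h(1) by (auto simp: complete_play_def)
    have last: "last (take (Suc i) h) = h ! i"
      using ij by (simp add: take_Suc_conv_app_nth)
    have "h ! j \<notin> set (take (Suc i) h)"
    proof
      assume "h ! j \<in> set (take (Suc i) h)"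
      then obtain m where "m < Suc i" "h ! m = h ! j" "m < length h" by (auto simp: in_set_conv_nth)
      then show False using dist ij ij' nth_eq_iff_index_eq by fastforce
    qed
    then have hj: "h ! j \<in> X - set (take (Suc i) h)" using X ij by auto
    have "\<exists>y\<in>X - set (take (Suc i) h). P (last (take (Suc i) h)) y"
      using hj P last by auto
    from s_partner[OF this] have sP: "s (take (Suc i) h) \<in> X" "P (h ! i) (s (take (Suc i) h))"
      unfolding last by auto
    have "h ! Suc i = s (take (Suc i) h)"
      using h(2) ij ij' by (simp add: breaker_follows_def)
    \<comment> \<open>Partners are unique, so Breaker's reply is \<open>h ! j\<close> itself, which
      would then occur twice in a distinct history.\<close>
    moreover have "s (take (Suc i) h) = h ! j"
      using partner_unique[OF _ _ _ sP(2) P] sP(1) X ij by auto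
    ultimately show False using dist ij ij' nth_eq_iff_index_eq by fastforce
  qed
  show thesis
  proof (rule that[OF strat])
    fix h x y
    assume h: "complete_play X h" "breaker_follows s h"
      and xy: "x \<in> maker_claimed h" "y \<in> maker_claimed h" and P: "P x y"
    obtain i j where ij: "i < length h" "even i" "x = h ! i" "j < length h" "even j" "y = h ! j"
      using xy by (auto simp: maker_claimed_def)
    show "x = y"
      using no_pair[OF h, of i j] no_pair[OF h, of j i] ij P sym by (metis linorder_neqE_nat)
  qed
qed

lemma maker_claimed_subset: "complete_play X h \<Longrightarrow> maker_claimed h \<subseteq> X"
  by (auto simp: maker_claimed_def complete_play_def)

lemma breaker_wins_by_pairing:
  assumes "\<And>x y. P x y \<Longrightarrow> P y x"
    and "\<And>x y z. x \<in> X \<Longrightarrow> y \<in> X \<Longrightarrow> z \<in> X \<Longrightarrow> P x y \<Longrightarrow> P x z \<Longrightarrow> y = z"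
    and pair: "\<And>x. k_distinct_solution A b x \<Longrightarrow> set\<^sub>v x \<subseteq> X \<Longrightarrow>
      \<exists>u\<in>set\<^sub>v x. \<exists>v\<in>set\<^sub>v x. u \<noteq> v \<and> P u v"
  shows "breaker_wins A b X"
proof -
  obtain s where s: "strategy_on X s"
    "\<And>h x y. complete_play X h \<Longrightarrow> breaker_follows s h \<Longrightarrow>
      x \<in> maker_claimed h \<Longrightarrow> y \<in> maker_claimed h \<Longrightarrow> P x y \<Longrightarrow> x = y"
    using pairing_strategy[of P X] assms(1,2) by metis
  have "\<not> contains_solution A b (maker_claimed h)"
    if play: "complete_play X h" "breaker_follows s h" for h
  proof
    assume "contains_solution A b (maker_claimed h)"
    then obtain x where x: "k_distinct_solution A b x" "set\<^sub>v x \<subseteq> maker_claimed h"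
      by (auto simp: contains_solution_def)
    then obtain u v where "u \<in> set\<^sub>v x" "v \<in> set\<^sub>v x" "u \<noteq> v" "P u v"
      using pair[of x] maker_claimed_subset[OF play(1)] by blast
    then show False using s(2)[OF play, of u v] x(2) by blast
  qed
  then show ?thesis using s(1) by (auto simp: breaker_wins_def)
qed

text \<open>Maker opens with \<open>v\<close>. Breaker's single reply cannot take both
  \<open>u\<close> and \<open>w\<close>, so her second move gets an end.\<close>

lemma maker_wins_through_middle:
  assumes uvw: "u \<in> X" "v \<in> X" "w \<in> X" "distinct [u, v, w]"
    and "\<And>M. {u, v} \<subseteq> M \<Longrightarrow> contains_solution A b M"
    and "\<And>M. {v, w} \<subseteq> M \<Longrightarrow> contains_solution A b M"
  shows "maker_wins A b X"
proof -
  define s where "s h = (if v \<notin> set h then v else if u \<notin> set h then u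
    else if w \<notin> set h then w else SOME x. x \<in> X - set h)" for h
  have "s h \<in> X - set h" if "set h \<subset> X" for h
  proof -
    have "\<exists>x. x \<in> X - set h" using that by blast
    from someI_ex[OF this] show ?thesis using uvw by (auto simp: s_def)
  qed
  then have "strategy_on X s" by (simp add: strategy_on_def)
  moreover have "contains_solution A b (maker_claimed h)"
    if h: "complete_play X h" "maker_follows s h" for h
  proof -
    have dist: "distinct h" and X: "set h = X" using h(1) by (auto simp: complete_play_def)
    \<comment> \<open>Three distinct numbers on the board ensure that a complete play reaches index
      2, Maker's second move.\<close>
    have "card {u, v, w} \<le> card (set h)" using X uvw by (intro card_mono) auto
    then have len: "3 \<le> length h" using uvw dist by (simp add: distinct_card)
    have "h ! i = s (take i h)" if "i < length h" "even i" for i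
      using h(2) that by (simp add: maker_follows_def)
    from this[of 0] this[of 2] have "h ! 0 = s []" "h ! 2 = s (take 2 h)"
      using len by (auto simp flip: length_greater_0_conv)
    moreover have take2: "take 2 h = [h ! 0, h ! 1]"
      using len by (cases h; cases "tl h") auto
    ultimately have h0: "h ! 0 = v" and h2: "h ! 2 = s [v, h ! 1]" by (simp_all add: s_def)
    have "h ! 2 = u \<or> h ! 2 = w"
      unfolding h2 using uvw(4) by (simp add: s_def)
    moreover have "h ! i \<in> maker_claimed h" if "i < length h" "even i" for i
      using that by (auto simp: maker_claimed_def)
    from this[of 0] this[of 2] have "v \<in> maker_claimed h" "h ! 2 \<in> maker_claimed h"
      using len h0 by (auto simp flip: length_greater_0_conv)
    ultimately show ?thesis using assms(5,6) by auto
  qed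
  ultimately show ?thesis by (auto simp: maker_wins_def)
qed

section \<open>Blocks of numbers contained in the random set\<close>

lemma prob_all_True_Pi_pmf:
  assumes "finite S" "T \<subseteq> S" "p \<in> {0..1}"
  shows "measure_pmf.prob (Pi_pmf S False (\<lambda>_. bernoulli_pmf p)) {f. \<forall>i\<in>T. f i} = p ^ card T"
proof -
  have "{f. \<forall>i\<in>T. f i} = Pi S (\<lambda>i. if i \<in> T then {True} else UNIV)"
    using assms(2) by (fastforce simp: Pi_def split: if_splits)
  then have "measure_pmf.prob (Pi_pmf S False (\<lambda>_. bernoulli_pmf p)) {f. \<forall>i\<in>T. f i}
      = (\<Prod>i\<in>S. measure_pmf.prob (bernoulli_pmf p) (if i \<in> T then {True} else UNIV))"
    using assms(1) by (simp only: measure_Pi_pmf_Pi)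
  also have "\<dots> = (\<Prod>i\<in>S. if i \<in> T then p else 1)"
    using assms(3) by (intro prod.cong) (auto simp: measure_pmf_single)
  also have "\<dots> = p ^ card T"
    using assms(1,2) by (simp add: prod.If_cases Int_absorb1)
  finally show ?thesis .
qed

lemma prob_pair_pmf_Times:
  "measure_pmf.prob (pair_pmf M N) (A \<times> B) = measure_pmf.prob M A * measure_pmf.prob N B"
proof -
  have "measure_pmf.prob (pair_pmf M N) (A \<times> B)
      = measure_pmf.prob (pair_pmf M N) ((A \<inter> set_pmf M) \<times> (B \<inter> set_pmf N))"
    by (subst measure_Int_set_pmf[symmetric]) (simp add: Times_Int_Times)
  \<comment> \<open>The product formula is applied to countable sets, hence the restriction to the
    supports.\<close>
  also have "\<dots> = measure_pmf.prob M (A \<inter> set_pmf M) * measure_pmf.prob N (B \<inter> set_pmf N)"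
    by (intro measure_pmf_prob_product) auto
  finally show ?thesis by (simp add: measure_Int_set_pmf)
qed

text \<open>Blocks are split off one at a time: the coordinates in \<open>T j\<close> are
  independent of those in \<open>S - T j\<close>, where all other blocks lie. The ground set shrinks
  in this step, so the induction generalises \<open>S\<close>.\<close>

lemma prob_no_block_Pi_pmf:
  assumes "finite I" "finite S" "disjoint_family_on T I" "\<And>i. i \<in> I \<Longrightarrow> T i \<subseteq> S"
    and "\<And>i. i \<in> I \<Longrightarrow> card (T i) = m" and p: "p \<in> {0..1}"
  shows "measure_pmf.prob (Pi_pmf S False (\<lambda>_. bernoulli_pmf p))
    {f. \<forall>i\<in>I. \<exists>x\<in>T i. \<not> f x} = (1 - p ^ m) ^ card I"
  using assms(1-5)
proof (induction I arbitrary: S rule: finite_induct)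
  case empty
  then show ?case by simp
next
  case (insert j I)
  let ?\<mu> = "\<lambda>S. Pi_pmf S False (\<lambda>_. bernoulli_pmf p)"
  let ?mix = "\<lambda>(f, g) x. if x \<in> T j then f x else g x :: bool"
  have Tj: "T j \<subseteq> S" "finite (T j)" "card (T j) = m"
    using insert.prems(1,3,4) finite_subset[of "T j" S] by auto
  have disj: "T i \<inter> T j = {}" if "i \<in> I" for i
    using that insert.prems(2) insert.hyps(2) by (auto simp: disjoint_family_on_def)
  have "?\<mu> S = ?\<mu> (T j \<union> (S - T j))"
    using Tj by (simp add: Un_absorb1)
  also have "\<dots> = map_pmf ?mix (pair_pmf (?\<mu> (T j)) (?\<mu> (S - T j)))"
    by (rule Pi_pmf_union) (use Tj insert.prems in auto)
  finally have split: "?\<mu> S = \<dots>" .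
  \<comment> \<open>The other blocks are disjoint from \<open>T j\<close>, so pulling the event back
    along \<open>?mix\<close> gives a rectangle with one factor for \<open>T j\<close> and one for
    the rest.\<close>
  have "measure_pmf.prob (?\<mu> S) {f. \<forall>i\<in>insert j I. \<exists>x\<in>T i. \<not> f x}
      = measure_pmf.prob (pair_pmf (?\<mu> (T j)) (?\<mu> (S - T j)))
          ({f. \<exists>x\<in>T j. \<not> f x} \<times> {f. \<forall>i\<in>I. \<exists>x\<in>T i. \<not> f x})"
  proof -
    have "(\<exists>x\<in>T i. \<not> ?mix (f, g) x) \<longleftrightarrow> (\<exists>x\<in>T i. \<not> g x)" if "i \<in> I" for i f g
      using disj[OF that] by auto
    then have "?mix -` {f. \<forall>i\<in>insert j I. \<exists>x\<in>T i. \<not> f x}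
        = {f. \<exists>x\<in>T j. \<not> f x} \<times> {f. \<forall>i\<in>I. \<exists>x\<in>T i. \<not> f x}"
      by (auto simp del: if_split split del: if_split)
    then show ?thesis unfolding split measure_map_pmf by simp
  qed
  also have "\<dots> = measure_pmf.prob (?\<mu> (T j)) {f. \<exists>x\<in>T j. \<not> f x}
      * measure_pmf.prob (?\<mu> (S - T j)) {f. \<forall>i\<in>I. \<exists>x\<in>T i. \<not> f x}"
    by (rule prob_pair_pmf_Times)
  also have "measure_pmf.prob (?\<mu> (S - T j)) {f. \<forall>i\<in>I. \<exists>x\<in>T i. \<not> f x} = (1 - p ^ m) ^ card I"
  proof (rule insert.IH)
    show "disjoint_family_on T I"
      using insert.prems(2) by (rule disjoint_family_on_mono[rotated]) auto
    show "T i \<subseteq> S - T j" if "i \<in> I" for i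
      using insert.prems(3)[of i] disj[OF that] that by blast
  qed (use insert.prems in auto)
  also have "measure_pmf.prob (?\<mu> (T j)) {f. \<exists>x\<in>T j. \<not> f x} = 1 - p ^ m"
  proof -
    have "{f. \<exists>x\<in>T j. \<not> f x} = UNIV - {f. \<forall>x\<in>T j. f x}" by auto
    then show ?thesis
      using measure_pmf.prob_compl[of "{f. \<forall>x\<in>T j. f x}" "?\<mu> (T j)"]
        prob_all_True_Pi_pmf[OF Tj(2) subset_refl p] Tj(3) by simp
  qed
  finally show ?case using insert.hyps by simp
qed

lemma prob_random_set:
  "measure_pmf.prob (random_set n p) {X. Q X}
    = measure_pmf.prob (Pi_pmf {1..int n} False (\<lambda>_. bernoulli_pmf p)) {f. Q {i \<in> {1..int n}. f i}}"
  by (simp add: random_set_def vimage_def)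

lemma set_random_set: "X \<in> set_pmf (random_set n p) \<Longrightarrow> X \<subseteq> {1..int n}"
  by (auto simp: random_set_def)

lemma prob_random_set_subset:
  assumes "T \<subseteq> {1..int n}" "p \<in> {0..1}"
  shows "measure_pmf.prob (random_set n p) {X. T \<subseteq> X} = p ^ card T"
proof -
  have "{f. T \<subseteq> {i \<in> {1..int n}. f i}} = {f. \<forall>i\<in>T. f i}"
    using assms(1) by auto
  then show ?thesis
    unfolding prob_random_set using prob_all_True_Pi_pmf[of "{1..int n}" T p] assms by simp
qed

lemma prob_random_set_contains_block:
  assumes "finite I" "disjoint_family_on T I" "\<And>i. i \<in> I \<Longrightarrow> T i \<subseteq> {1..int n}"
    and "\<And>i. i \<in> I \<Longrightarrow> card (T i) = m" and "p \<in> {0..1}"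
  shows "measure_pmf.prob (random_set n p) {X. \<exists>i\<in>I. T i \<subseteq> X} = 1 - (1 - p ^ m) ^ card I"
proof -
  let ?\<mu> = "Pi_pmf {1..int n} False (\<lambda>_. bernoulli_pmf p)"
  have "{f. \<exists>i\<in>I. T i \<subseteq> {i \<in> {1..int n}. f i}} = UNIV - {f. \<forall>i\<in>I. \<exists>x\<in>T i. \<not> f x}"
    using assms(3) by blast
  then show ?thesis
    unfolding prob_random_set
    using measure_pmf.prob_compl[of "{f. \<forall>i\<in>I. \<exists>x\<in>T i. \<not> f x}" ?\<mu>]
      prob_no_block_Pi_pmf[OF assms(1) finite_atLeastAtMost_int assms(2,3,4,5)] by simp
qed

text \<open>The union bound; the blocks may overlap here, as paths in the graph do.\<close>

lemma prob_random_set_contains_le: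
  fixes p :: real
  assumes "finite I" "\<And>i. i \<in> I \<Longrightarrow> T i \<subseteq> {1..int n}"
    and "\<And>i. i \<in> I \<Longrightarrow> card (T i) = m" and "p \<in> {0..1}"
  shows "measure_pmf.prob (random_set n p) {X. \<exists>i\<in>I. T i \<subseteq> X} \<le> card I * p ^ m"
proof -
  have "{X. \<exists>i\<in>I. T i \<subseteq> X} = (\<Union>i\<in>I. {X. T i \<subseteq> X})" by auto
  then have "measure_pmf.prob (random_set n p) {X. \<exists>i\<in>I. T i \<subseteq> X}
      \<le> (\<Sum>i\<in>I. measure_pmf.prob (random_set n p) {X. T i \<subseteq> X})"
    using assms(1) by (simp add: measure_pmf.finite_measure_subadditive_finite)
  also have "\<dots> = (\<Sum>i\<in>I. p ^ m)"
    using assms by (intro sum.cong) (auto simp: prob_random_set_subset)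
  finally show ?thesis by simp
qed

lemma whpI:
  assumes "eventually (\<lambda>n. measure_pmf.prob (random_set n (p n)) {X. Q X} \<ge> 1 - \<epsilon> n) sequentially"
    and "\<epsilon> \<longlonglongrightarrow> 0"
  shows "whp p Q"
  unfolding whp_def
proof (rule tendsto_sandwich)
  show "(\<lambda>n. 1 - \<epsilon> n) \<longlonglongrightarrow> 1" using tendsto_diff[OF tendsto_const assms(2), of 1] by simp
qed (use assms(1) in auto)

text \<open>This turns both threshold conditions into statements about \<open>n * p ^ 3\<close>. At
  \<open>n = 0\<close> both sides are 0, since \<open>0 powr (-1/3) = 0\<close> and division by 0
  gives 0.\<close>

lemma cube_div_powr: "(x / real n powr (-1/3)) ^ 3 = real n * x ^ 3"
proof (cases "n = 0")
  case False
  then have "(real n powr (-1/3)) ^ 3 = real n powr (-1)"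
    by (simp add: powr_power)
  then show ?thesis using False by (simp only: power_divide) (simp add: powr_minus_divide)
qed simp

section \<open>Failure of \<open>satisfies_star\<close> and Breaker's win below the
  threshold\<close>

text \<open>Every elementary row operation multiplies from the left by an elementary matrix;
  \<open>P\<close> is the product of these.\<close>

lemma row_ops_left_mult:
  assumes "row_op\<^sup>*\<^sup>* A B" "A \<in> carrier_mat l k"
  shows "\<exists>P\<in>carrier_mat l l. B = P * A"
  using assms(1)
proof (induction rule: rtranclp_induct)
  case base
  then show ?case using assms(2) by (intro bexI[of _ "1\<^sub>m l"]) auto
next
  case (step B C)
  then obtain P where P: "P \<in> carrier_mat l l" "B = P * A" by blast
  then have B: "B \<in> carrier_mat l k" using assms(2) by auto
  have "\<exists>R\<in>carrier_mat l l. C = R * B"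
    using step.hyps(2)
  proof cases
    case (swap i j)
    then show ?thesis using B by (intro bexI[of _ "swaprows_mat l i j"]) (auto simp: swaprows_mat)
  next
    case (scale i c)
    then show ?thesis using B by (intro bexI[of _ "multrow_mat l i c"]) (auto simp: multrow_mat)
  next
    case (add i j c)
    then show ?thesis using B by (intro bexI[of _ "addrow_mat l c i j"]) (auto simp: addrow_mat)
  qed
  then obtain R where R: "R \<in> carrier_mat l l" "C = R * B" by blast
  then have "C = (R * P) * A" using P assms(2) by (simp add: assoc_mult_mat[of R l l P l A k])
  then show ?case using R P by (intro bexI[of _ "R * P"]) auto
qed

text \<open>A row of \<open>B = P * A\<close> with exactly two non-zero entries is a linear form in
  two coordinates, and its value at \<open>x\<close> depends only on \<open>A *\<^sub>v x\<close>.
  Comparing \<open>x\<close> with \<open>y\<close> keeps the choice of \<open>i\<close>,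
  \<open>j\<close>, \<open>r\<close>, \<open>s\<close> independent of \<open>b\<close>.\<close>

lemma two_variable_consequence:
  assumes A: "A \<in> carrier_mat l k" and "\<not> satisfies_star A"
  obtains i j r s where "i < k" "j < k" "i \<noteq> j" "r \<noteq> 0" "s \<noteq> 0"
    and "\<And>x y. x \<in> carrier_vec k \<Longrightarrow> y \<in> carrier_vec k \<Longrightarrow> A *\<^sub>v x = A *\<^sub>v y \<Longrightarrow>
      r * rat_of_int (x $ i) + s * rat_of_int (x $ j) = r * rat_of_int (y $ i) + s * rat_of_int (y $ j)"
proof -
  let ?A = "map_mat rat_of_int A"
  obtain B m where B: "row_op\<^sup>*\<^sup>* ?A B" "m < dim_row B"
    "card {j. j < dim_col B \<and> B $$ (m, j) \<noteq> 0} = 2"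
    using assms(2) by (auto simp: satisfies_star_def)
  obtain P where P: "P \<in> carrier_mat l l" "B = P * ?A"
    using row_ops_left_mult[OF B(1), of l k] A by auto
  have Bc: "B \<in> carrier_mat l k" using P A by auto
  obtain i j where ij: "{j. j < k \<and> B $$ (m, j) \<noteq> 0} = {i, j}" "i \<noteq> j"
    using B(3) Bc by (auto simp: card_2_iff)
  have ij_nz: "i < k" "j < k" "B $$ (m, i) \<noteq> 0" "B $$ (m, j) \<noteq> 0"
    using ij(1) by blast+
  have zero: "B $$ (m, t) = 0" if "t < k" "t \<noteq> i" "t \<noteq> j" for t
    using ij(1) that by blast
  have row_value: "(B *\<^sub>v map_vec rat_of_int x) $ m
      = B $$ (m, i) * rat_of_int (x $ i) + B $$ (m, j) * rat_of_int (x $ j)"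
    if "x \<in> carrier_vec k" for x
  proof -
    have "(B *\<^sub>v map_vec rat_of_int x) $ m = (\<Sum>t = 0..<k. B $$ (m, t) * rat_of_int (x $ t))"
      using B(2) Bc that by (auto simp: scalar_prod_def intro!: sum.cong)
    also have "\<dots> = (\<Sum>t\<in>{i, j}. B $$ (m, t) * rat_of_int (x $ t))"
      by (rule sum.mono_neutral_right) (use ij_nz(1,2) zero in simp_all)
    finally show ?thesis using ij(2) by simp
  qed
  have "B *\<^sub>v map_vec rat_of_int x = P *\<^sub>v map_vec rat_of_int (A *\<^sub>v x)"
    if "x \<in> carrier_vec k" for x
    using that A P
    by (simp add: of_int_hom.mult_mat_vec_hom[OF A that] assoc_mult_mat_vec[of P l l ?A k])
  with row_value have "B $$ (m, i) * rat_of_int (x $ i) + B $$ (m, j) * rat_of_int (x $ j)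
      = B $$ (m, i) * rat_of_int (y $ i) + B $$ (m, j) * rat_of_int (y $ j)"
    if "x \<in> carrier_vec k" "y \<in> carrier_vec k" "A *\<^sub>v x = A *\<^sub>v y" for x y
    using that by metis
  then show thesis
    using that[of i j "B $$ (m, i)" "B $$ (m, j)"] ij(2) ij_nz by blast
qed

text \<open>Two different neighbours of a vertex cannot both be successors or both be predecessors,
  so they would form a path with it. Without paths, neighbours are unique and Breaker can pair.
  Loops \<open>E u u\<close> are possible and are removed from the pairing relation.\<close>

lemma breaker_wins_no_path:
  assumes pair: "\<And>x. k_distinct_solution A b x \<Longrightarrow> \<exists>u\<in>set\<^sub>v x. \<exists>v\<in>set\<^sub>v x. u \<noteq> v \<and> E u v"
    and E: "\<And>u v w. E u v \<Longrightarrow> E u w \<Longrightarrow> v = w" "\<And>u v w. E u w \<Longrightarrow> E v w \<Longrightarrow> u = v"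
    and no_path: "\<And>u v w. {u, v, w} \<subseteq> X \<Longrightarrow> distinct [u, v, w] \<Longrightarrow> E u v \<Longrightarrow> E v w \<Longrightarrow> False"
  shows "breaker_wins A b X"
proof (rule breaker_wins_by_pairing[where P = "\<lambda>x y. x \<noteq> y \<and> (E x y \<or> E y x)"])
  fix x y z
  assume xyz: "x \<in> X" "y \<in> X" "z \<in> X" "x \<noteq> y \<and> (E x y \<or> E y x)" "x \<noteq> z \<and> (E x z \<or> E z x)"
  show "y = z"
  proof (rule ccontr)
    assume "y \<noteq> z"
    then show False
      using xyz E(1)[of x y z] E(2)[of y x z] no_path[of y x z] no_path[of z x y] by auto
  qed
qed (use pair in blast)+

lemma breaker_whp:
  assumes A: "A \<in> carrier_mat l k" and star: "\<not> satisfies_star A"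
    and p: "\<And>n. p n \<in> {0..1}" "p \<lless> (\<lambda>n. real n powr (-1/3))"
  shows "whp p (breaker_wins A b)"
proof -
  obtain i j r s where ij: "i < k" "j < k" "i \<noteq> j" and rs: "r \<noteq> 0" "s \<noteq> 0"
    and cons: "\<And>x y. x \<in> carrier_vec k \<Longrightarrow> y \<in> carrier_vec k \<Longrightarrow> A *\<^sub>v x = A *\<^sub>v y \<Longrightarrow>
      r * rat_of_int (x $ i) + s * rat_of_int (x $ j) = r * rat_of_int (y $ i) + s * rat_of_int (y $ j)"
    using two_variable_consequence[OF A star] by metis
  \<comment> \<open>The constant is read off from any one solution; if there is none, every
    \<open>c\<close> works.\<close>
  have "\<exists>c. \<forall>x. k_distinct_solution A b x \<longrightarrow> r * rat_of_int (x $ i) + s * rat_of_int (x $ j) = c"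
  proof (cases "\<exists>y. k_distinct_solution A b y")
    case True
    then obtain y where "k_distinct_solution A b y" ..
    then have "r * rat_of_int (x $ i) + s * rat_of_int (x $ j)
        = r * rat_of_int (y $ i) + s * rat_of_int (y $ j)" if "k_distinct_solution A b x" for x
      using that A by (intro cons) (simp_all add: k_distinct_solution_def)
    then show ?thesis by blast
  qed blast
  then obtain c where c: "\<And>x. k_distinct_solution A b x \<Longrightarrow>
      r * rat_of_int (x $ i) + s * rat_of_int (x $ j) = c" by blast
  define E where "E u v \<longleftrightarrow> r * rat_of_int u + s * rat_of_int v = c" for u v
  have E: "E u v \<Longrightarrow> E u w \<Longrightarrow> v = w" "E u w \<Longrightarrow> E v w \<Longrightarrow> u = v" for u v w
    using rs by (auto simp: E_def)
  have pair: "\<exists>u\<in>set\<^sub>v x. \<exists>v\<in>set\<^sub>v x. u \<noteq> v \<and> E u v" if x: "k_distinct_solution A b x" for x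
  proof (intro bexI conjI)
    show "x $ i \<noteq> x $ j" using x ij A by (auto simp: k_distinct_solution_def inj_on_def)
    show "E (x $ i) (x $ j)" using c[OF x] by (simp add: E_def)
    show "x $ i \<in> set\<^sub>v x" "x $ j \<in> set\<^sub>v x"
      using x ij A by (auto simp: k_distinct_solution_def intro!: vec_setI)
  qed
  define I where "I n = {(u, v, w). {u, v, w} \<subseteq> {1..int n} \<and> distinct [u, v, w] \<and> E u v \<and> E v w}" for n
  define T where "T = (\<lambda>(u, v, w). {u, v, w :: int})"
  have "1 - real n * p n ^ 3 \<le> measure_pmf.prob (random_set n (p n)) {X. breaker_wins A b X}" for n
  proof -
    \<comment> \<open>The middle vertex determines both ends, so there are at most \<open>n\<close>
      paths.\<close>
    have inj: "inj_on (fst \<circ> snd) (I n)"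
      using E by (fastforce simp: inj_on_def I_def)
    have img: "(fst \<circ> snd) ` I n \<subseteq> {1..int n}" by (auto simp: I_def)
    have "finite (I n)"
      by (rule inj_on_finite[OF inj img]) simp
    have "card (I n) \<le> n"
      using card_inj_on_le[OF inj img] by simp
    have "measure_pmf.prob (random_set n (p n)) {X. \<exists>t\<in>I n. T t \<subseteq> X} \<le> card (I n) * p n ^ 3"
      by (rule prob_random_set_contains_le) (use \<open>finite (I n)\<close> p(1) in \<open>auto simp: I_def T_def\<close>)
    also have "\<dots> \<le> n * p n ^ 3"
      using \<open>card (I n) \<le> n\<close> p(1)[of n] by (intro mult_right_mono) auto
    finally have "1 - n * p n ^ 3
        \<le> 1 - measure_pmf.prob (random_set n (p n)) {X. \<exists>t\<in>I n. T t \<subseteq> X}" by simp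
    also have "\<dots> = measure_pmf.prob (random_set n (p n)) (UNIV - {X. \<exists>t\<in>I n. T t \<subseteq> X})"
      using measure_pmf.prob_compl[of "{X. \<exists>t\<in>I n. T t \<subseteq> X}" "random_set n (p n)"] by simp
    also have "\<dots> \<le> measure_pmf.prob (random_set n (p n)) {X. breaker_wins A b X}"
    proof (rule measure_pmf.finite_measure_mono_AE)
      \<comment> \<open>On the support, \<open>X\<close> lies in \<open>[n]\<close>, so every path
        inside \<open>X\<close> is counted by \<open>I n\<close>.\<close>
      show "AE X in random_set n (p n). X \<in> UNIV - {X. \<exists>t\<in>I n. T t \<subseteq> X}
          \<longrightarrow> X \<in> {X. breaker_wins A b X}"
      proof (subst AE_measure_pmf_iff, intro ballI impI)
        fix X assume "X \<in> set_pmf (random_set n (p n))" and X: "X \<in> UNIV - {X. \<exists>t\<in>I n. T t \<subseteq> X}"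
        then have sub: "X \<subseteq> {1..int n}" using set_random_set by blast
        have no_path: False if "{u, v, w} \<subseteq> X" "distinct [u, v, w]" "E u v" "E v w" for u v w
        proof -
          have "(u, v, w) \<in> I n" unfolding I_def using that subset_trans[OF that(1) sub] by simp
          moreover have "T (u, v, w) \<subseteq> X" using that(1) by (simp add: T_def)
          ultimately show False using X by blast
        qed
        have "breaker_wins A b X" by (rule breaker_wins_no_path[OF pair E no_path])
        then show "X \<in> {X. breaker_wins A b X}" by simp
      qed
    qed simp
    finally show ?thesis .
  qed
  moreover have "(\<lambda>n. real n * p n ^ 3) \<longlonglongrightarrow> 0"
    using tendsto_power[OF p(2)[unfolded much_less_def], of 3] by (simp only: cube_div_powr) simp
  ultimately show ?thesis by (intro whpI[where \<epsilon> = "\<lambda>n. real n * p n ^ 3"]) auto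
qed

section \<open>Breaker's win for geometric progressions\<close>

text \<open>Some prime \<open>q\<close> has different multiplicities in \<alpha> and \<beta>. The
  multiplicity of \<open>q\<close> then measures the position along a path, and \<open>e\<close> is
  the parity of that position.\<close>

lemma alternating_coloring:
  fixes \<alpha> \<beta> :: int
  assumes "\<alpha> > 0" "\<beta> > 0" "\<alpha> \<noteq> \<beta>"
  obtains e :: "int \<Rightarrow> bool" where "\<And>x y. x > 0 \<Longrightarrow> y > 0 \<Longrightarrow> \<alpha> * x = \<beta> * y \<Longrightarrow> e x \<noteq> e y"
proof -
  obtain q where q: "prime q" "multiplicity q \<alpha> \<noteq> multiplicity q \<beta>"
    using multiplicity_eq_int[OF assms(1,2)] assms(3) by blast
  define D where "D = int (multiplicity q \<alpha>) - int (multiplicity q \<beta>)"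
  \<comment> \<open>An edge \<open>\<alpha> x = \<beta> y\<close> increases the multiplicity of \<open>q\<close> by exactly \<open>D \<noteq> 0\<close>.\<close>
  define e where "e x = even (int (multiplicity q x) div D)" for x :: int
  show thesis
  proof (rule that[of e])
    fix x y :: int assume xy: "x > 0" "y > 0" "\<alpha> * x = \<beta> * y"
    have "multiplicity q (\<alpha> * x) = multiplicity q \<alpha> + multiplicity q x"
      "multiplicity q (\<beta> * y) = multiplicity q \<beta> + multiplicity q y"
      by (rule prime_elem_multiplicity_mult_distrib; use xy assms q(1) in auto)+
    then have "int (multiplicity q y) = int (multiplicity q x) + D"
      using xy(3) by (simp add: D_def)
    moreover have "D \<noteq> 0" using q(2) by (simp add: D_def)
    \<comment> \<open>\<open>D\<close> may be negative, but adding \<open>D\<close> to the dividend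
      raises the quotient by 1 for either sign.\<close>
    ultimately have "int (multiplicity q y) div D = int (multiplicity q x) div D + 1"
      by simp
    then show "e x \<noteq> e y" by (simp add: e_def)
  qed
qed

text \<open>\<open>R\<close> keeps the edges whose initial vertex satisfies \<open>e\<close>.
  Consecutive edges have initial vertices of different colours, so \<open>R\<close> is a matching
  that contains one of the two edges of every solution.\<close>

lemma breaker_wins_geometric:
  fixes \<alpha> \<beta> :: int
  assumes \<alpha>\<beta>: "\<alpha> > 0" "\<beta> > 0" "\<alpha> \<noteq> \<beta>" and X: "X \<subseteq> {1..}"
  shows "breaker_wins (mat_of_rows_list 3 [[\<alpha>, -\<beta>, 0], [0, \<alpha>, -\<beta>]]) (0\<^sub>v 2) X"
proof -
  obtain e :: "int \<Rightarrow> bool"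
    where e: "\<And>x y. x > 0 \<Longrightarrow> y > 0 \<Longrightarrow> \<alpha> * x = \<beta> * y \<Longrightarrow> e x \<noteq> e y"
    using alternating_coloring[OF \<alpha>\<beta>] by metis
  let ?A = "mat_of_rows_list 3 [[\<alpha>, -\<beta>, 0], [0, \<alpha>, -\<beta>]]"
  define R where "R x y \<longleftrightarrow> x > 0 \<and> y > 0 \<and> \<alpha> * x = \<beta> * y \<and> e x" for x y
  have R: "R x y \<Longrightarrow> R x z \<Longrightarrow> y = z" "R x z \<Longrightarrow> R y z \<Longrightarrow> x = y" "R x y \<Longrightarrow> R y z \<Longrightarrow> False" for x y z
    using \<alpha>\<beta> e[of x y] by (auto simp: R_def) (metis less_irrefl mult_cancel_left)
  show ?thesis
  proof (rule breaker_wins_by_pairing[where P = "\<lambda>x y. R x y \<or> R y x"])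
    fix x assume x: "k_distinct_solution ?A (0\<^sub>v 2) x" "set\<^sub>v x \<subseteq> X"
    then have dim: "dim_vec x = 3" and inj: "inj_on (vec_index x) {..<3}"
      and eq: "?A *\<^sub>v x = 0\<^sub>v 2"
      by (auto simp: k_distinct_solution_def mat_of_rows_list_def)
    have "(?A *\<^sub>v x) $ 0 = 0" "(?A *\<^sub>v x) $ 1 = 0" unfolding eq by auto
    then have eqs: "\<alpha> * x $ 0 = \<beta> * x $ 1" "\<alpha> * x $ 1 = \<beta> * x $ 2"
      using dim by (auto simp: mat_of_rows_list_def scalar_prod_def numeral_3_eq_3 numeral_2_eq_2)
    have mem: "x $ 0 \<in> set\<^sub>v x" "x $ 1 \<in> set\<^sub>v x" "x $ 2 \<in> set\<^sub>v x"
      using dim by (auto intro!: vec_setI)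
    then have pos: "x $ 0 > 0" "x $ 1 > 0" "x $ 2 > 0" using x(2) X by fastforce+
    have ne: "x $ 0 \<noteq> x $ 1" "x $ 1 \<noteq> x $ 2"
      using inj_onD[OF inj, of 0 1] inj_onD[OF inj, of 1 2] by auto
    have "R (x $ 0) (x $ 1) \<or> R (x $ 1) (x $ 2)"
      using pos eqs e[of "x $ 0" "x $ 1"] by (auto simp: R_def)
    then show "\<exists>u\<in>set\<^sub>v x. \<exists>v\<in>set\<^sub>v x. u \<noteq> v \<and> (R u v \<or> R v u)"
      using mem ne by blast
  qed (use R in blast)+
qed

section \<open>Linearly many disjoint paths\<close>

text \<open>The edge can be moved to \<open>(x + b * t, y + a * t)\<close>. It extends to a path
  once \<open>a * (y + a * t)\<close> is congruent to \<open>c\<close> modulo \<open>b\<close>,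
  which is solvable for \<open>t\<close> because \<open>a * a\<close> is invertible modulo
  \<open>b\<close>.\<close>

lemma path_exists:
  fixes a b c :: int
  assumes "coprime a b" "a * x - b * y = c"
  obtains u v w where "a * u - b * v = c" "a * v - b * w = c"
proof -
  have "coprime (a * a) b" using assms(1) by simp
  then obtain s where s: "[(a * a) * s = 1] (mod b)"
    using cong_solve_coprime_int by blast
  define t where "t = s * (c - a * y)"
  have "[(a * a) * t = 1 * (c - a * y)] (mod b)"
    unfolding t_def mult.assoc[symmetric] by (intro cong_mult s cong_refl)
  then have "b dvd a * a * t - (c - a * y)" by (simp add: cong_iff_dvd_diff)
  then obtain w where "a * a * t - (c - a * y) = b * w" by (elim dvdE)
  then have "a * (y + a * t) - b * w = c" by (simp add: algebra_simps)
  moreover have "a * (x + b * t) - b * (y + a * t) = c" using assms(2) by (simp add: algebra_simps)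
  ultimately show thesis using that by blast
qed

text \<open>Since \<open>a \<ge> b + 1\<close>, the difference \<open>a * t' - b * t\<close> is at
  least \<open>(b + 1) * N - b * (N + M) = N - b * M\<close>, hence at least
  \<open>2 * C + 1\<close>. This exceeds \<open>x - y\<close>, and the factor
  \<open>d \<ge> 1\<close> preserves the bound.\<close>

lemma progression_less_progression:
  fixes a b d x y C M N t t' :: int
  assumes "0 < b" "b < a" "0 \<le> M" "\<bar>x\<bar> \<le> C" "\<bar>y\<bar> \<le> C" "N \<ge> 2 * C + a * a * M + 1"
    "N \<le> t" "t < N + M" "N \<le> t'" "0 < d"
  shows "x + d * b * t < y + d * a * t'"
proof -
  have M: "b * M \<le> a * a * M" using assms(1-3) 
    by (intro mult_right_mono) (auto intro: order.trans[OF _ mult_mono[of 1 a b a]])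
  moreover have "0 \<le> a * a * M" using assms(3) by simp
  ultimately have N: "0 \<le> N" using assms by linarith
  have "b * t \<le> b * N + b * M" using mult_left_mono[of t "N+M" b] assms by (simp add: algebra_simps)
  moreover have "(b + 1) * N \<le> a * t'" using assms using N by (intro mult_mono) auto
  ultimately have "b * t + (2 * C + 1) \<le> a * t'"
    using M assms(6) unfolding distrib_right by linarith
  then have "d * (b * t + (2 * C + 1)) \<le> d * (a * t')" using assms by (intro mult_left_mono) auto
  moreover have "2 * C + 1 \<le> d * (2 * C + 1)" using mult_right_mono[of 1 d "2*C+1"] assms by simp
  ultimately show ?thesis using assms by (simp add: algebra_simps)
qed

definition is_path :: "int \<Rightarrow> int \<Rightarrow> int \<Rightarrow> int \<Rightarrow> int \<Rightarrow> int \<Rightarrow> bool" where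
  "is_path a b c u v w \<longleftrightarrow> a * u - b * v = c \<and> a * v - b * w = c \<and> distinct [u, v, w]"

text \<open>The bound \<open>n \<le> K * card I\<close> says that there are at least
  \<open>n / K\<close> paths, without division.\<close>

definition many_disjoint_paths :: "int \<Rightarrow> int \<Rightarrow> int \<Rightarrow> nat \<Rightarrow> nat \<Rightarrow> bool" where
  "many_disjoint_paths a b c K n \<longleftrightarrow>
    (\<exists>(I :: int set) u v w. finite I \<and> n \<le> K * card I \<and>
      disjoint_family_on (\<lambda>t. {u t, v t, w t}) I \<and>
      (\<forall>t\<in>I. is_path a b c (u t) (v t) (w t) \<and> {u t, v t, w t} \<subseteq> {1..int n}))"

lemma disjoint_paths_coprime:
  fixes a b c :: int
  assumes ab: "coprime a b" "0 < b" "b < a" and sol: "a * x - b * y = c"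
  obtains K where "K > 0" "\<And>n. n \<ge> K \<Longrightarrow> many_disjoint_paths a b c K n"
proof -
  obtain u0 v0 w0 where path0: "a * u0 - b * v0 = c" "a * v0 - b * w0 = c"
    using path_exists[OF ab(1) sol] .
  define C where "C = \<bar>u0\<bar> + \<bar>v0\<bar> + \<bar>w0\<bar>"
  have C: "\<bar>u0\<bar> \<le> C" "\<bar>v0\<bar> \<le> C" "\<bar>w0\<bar> \<le> C" "0 \<le> C" by (auto simp: C_def)
  \<comment> \<open>\<open>L\<close> and \<open>C0\<close> are chosen so that the largest vertex
    \<open>w t\<close> is at most \<open>C0 + L * M\<close>.\<close>
  define L where "L = a * a * (a * a + 1)"
  define C0 where "C0 = C + a * a * (2 * C + 1)"
  have L: "L \<ge> 1" and C0: "C0 \<ge> 0" using ab C(4) mult_pos_pos[of a a]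
    by (auto simp: L_def C0_def int_one_le_iff_zero_less intro!: mult_pos_pos add_nonneg_nonneg)
  \<comment> \<open>For \<open>n \<ge> K\<close>, the summand \<open>4 * L\<close> yields
    \<open>M \<ge> 1\<close>, and \<open>2 * C0\<close> yields
    \<open>C0 \<le> n / 2\<close>.\<close>
  define K where "K = nat (4 * L + 2 * C0)"
  have K: "int K = 4 * L + 2 * C0" using L C0 by (simp add: K_def)
  \<comment> \<open>The triple \<open>(b * b, b * a, a * a)\<close> solves the homogeneous path
    equations, so each shift of the base path is again a path.\<close>
  define u v w where "u t = u0 + b * b * t" and "v t = v0 + b * a * t" and "w t = w0 + a * a * t" for t
  show thesis
  proof (rule that[of K])
    show "K > 0" using K L C0 by simp
    fix n assume n: "n \<ge> K"
    \<comment> \<open>\<open>M\<close> is the number of paths; \<open>L * M\<close> uses at most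
      half of \<open>n\<close> and leaves the other half for \<open>C0\<close>.\<close>
    define M where "M = int n div (2 * L)"
    \<comment> \<open>\<open>N\<close> is so much larger than \<open>M\<close> that the ranges of \<open>u\<close>, \<open>v\<close>, \<open>w\<close> on \<open>{N..<N + M}\<close> are separated.\<close>
    define N where "N = 2 * C + a * a * M + 1"
    have M0: "M \<ge> 0" using L by (simp add: M_def pos_imp_zdiv_nonneg_iff)
    have nLM: "2 * L * M \<le> int n" "int n < 2 * L * M + 2 * L"
      using L pos_mod_bound[of "2 * L" "int n"] pos_mod_sign[of "2 * L" "int n"]
        mult_div_mod_eq[of "2 * L" "int n"] unfolding M_def by linarith+
    have M1: "M \<ge> 1"
    proof (rule ccontr)
      assume "\<not> M \<ge> 1"
      then have "M = 0" using M0 by simp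
      then show False using nLM(2) n K L C0 by simp
    qed
    have "2 * L * 1 \<le> 2 * L * M" using M1 L by (intro mult_left_mono) auto
    then have nM: "int n \<le> 4 * L * M" using nLM(2) by simp
    define I where "I = {N..<N + M}"
    have less: "u t < v t'" "v t < w t'" "u t < w t'" if "t \<in> I" "t' \<in> I" for t t'
    proof -
      \<comment> \<open>The slopes of \<open>u\<close> and \<open>v\<close> share the factor
        \<open>b\<close>, those of \<open>v\<close> and \<open>w\<close> the factor
        \<open>a\<close>; these are the values of \<open>d\<close>.\<close>
      have uv: "u t < v t'" and vw: "v t < w t'" if "t \<in> I" "t' \<in> I" for t t'
        using that progression_less_progression[of b a M u0 C v0 N t t' b]
          progression_less_progression[of b a M v0 C w0 N t t' a] ab C M0
        by (simp_all add: I_def N_def u_def v_def w_def mult.commute[of b a])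
      show "u t < v t'" "v t < w t'" "u t < w t'"
        using uv[OF that] vw[OF that] uv[OF that(1,1)] by simp_all
    qed
    show "many_disjoint_paths a b c K n"
      unfolding many_disjoint_paths_def
    proof (intro exI conjI ballI)
      show "finite I" by (simp add: I_def)
      have "int n \<le> int K * M" 
        using nM mult_right_mono[of "4 * L" "int K" M] K C0 M0 by linarith
      then show "n \<le> K * card I" using M0 by (simp add: I_def nat_le_iff flip: of_nat_le_iff[where 'a = int])
      have inj: "u t = u t' \<Longrightarrow> t = t'" "v t = v t' \<Longrightarrow> t = t'" "w t = w t' \<Longrightarrow> t = t'" for t t'
        using ab by (auto simp: u_def v_def w_def)
      have "{u t, v t, w t} \<inter> {u t', v t', w t'} = {}" if "t \<in> I" "t' \<in> I" "t \<noteq> t'" for t t'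
        using that inj[of t t'] less[of t t'] less[of t' t] by auto
      then show "disjoint_family_on (\<lambda>t. {u t, v t, w t}) I"
        by (simp add: disjoint_family_on_def)
      fix t assume t: "t \<in> I"
      show "is_path a b c (u t) (v t) (w t)"
        using path0 less[OF t t] by (simp add: is_path_def u_def v_def w_def algebra_simps)
      have "0 \<le> a * a * M" using M0 by simp
      moreover have "N \<le> t" using t by (simp add: I_def)
      ultimately have t0: "2 * C + 1 \<le> t" unfolding N_def by linarith
      have "1 * t \<le> b * b * t"
      proof (rule mult_right_mono)
        show "1 \<le> b * b" using mult_pos_pos[OF ab(2,2)] by linarith
      qed (use t0 C in linarith)
      then have "1 \<le> u t" using t0 C unfolding u_def by linarith
      moreover have "w t \<le> int n"
      proof -
        have "a * a * t \<le> a * a * (N + M)"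
          using t ab by (intro mult_left_mono) (auto simp: I_def)
        also have "\<dots> = a * a * (2 * C + 1) + L * M"
          by (simp add: N_def L_def algebra_simps)
        finally have "w t \<le> C0 + L * M" using C by (simp add: w_def C0_def)
        then show ?thesis using nLM n K L by simp
      qed
      ultimately show "{u t, v t, w t} \<subseteq> {1..int n}" using less[OF t t] by auto
    qed
  qed
qed

text \<open>Dividing by the gcd leaves the paths unchanged; the given solution makes
  \<open>c\<close> divisible by it. If \<open>a < b\<close>, reading paths backwards exchanges
  \<open>a\<close> and \<open>b\<close> and negates the constant.\<close>

lemma disjoint_paths:
  fixes \<alpha> \<beta> c :: int
  assumes pos: "0 < \<alpha>" "0 < \<beta>" and ne: "\<alpha> \<noteq> \<beta>" and sol: "\<alpha> * x - \<beta> * y = c"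
  obtains K where "K > 0" "\<And>n. n \<ge> K \<Longrightarrow> many_disjoint_paths \<alpha> \<beta> c K n"
proof -
  define g where "g = gcd \<alpha> \<beta>"
  define a b where "a = \<alpha> div g" and "b = \<beta> div g"
  have g: "g > 0" using pos by (simp add: g_def)
  have ab: "\<alpha> = g * a" "\<beta> = g * b" by (simp_all add: a_def b_def g_def)
  have cop: "coprime a b" unfolding a_def b_def g_def using pos by (intro div_gcd_coprime) auto
  have abpos: "0 < a" "0 < b" "a \<noteq> b" using pos ne g by (auto simp: ab zero_less_mult_iff)
  define d where "d = a * x - b * y"
  have c: "c = g * d" using sol by (simp add: ab d_def algebra_simps)
  have scale: "is_path \<alpha> \<beta> c u v w \<longleftrightarrow> is_path a b d u v w" for u v w
  proof -
    have "\<alpha> * u - \<beta> * v = g * (a * u - b * v)" for u v by (simp add: ab algebra_simps)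
    then show ?thesis using g by (simp add: is_path_def c)
  qed
  consider "b < a" | "a < b" using abpos by linarith
  then show thesis
  proof cases
    case 1
    then obtain K where "K > 0" "\<And>n. n \<ge> K \<Longrightarrow> many_disjoint_paths a b d K n"
      using disjoint_paths_coprime[OF cop abpos(2) _ d_def[symmetric]] by blast
    then show thesis
      using that by (simp add: many_disjoint_paths_def scale)
  next
    case 2
    have rev: "is_path a b d u v w \<longleftrightarrow> is_path b a (- d) w v u" for u v w
      by (auto simp: is_path_def)
    have "coprime b a" "b * y - a * x = - d" using cop by (auto simp: coprime_commute d_def)
    then obtain K where K: "K > 0" "\<And>n. n \<ge> K \<Longrightarrow> many_disjoint_paths b a (- d) K n"
      using disjoint_paths_coprime[OF _ abpos(1) 2] by blast
    show thesis
    proof (rule that[OF K(1)])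
      fix n assume "n \<ge> K"
      from K(2)[OF this] obtain I :: "int set" and u v w where
        I: "finite I" "n \<le> K * card I" "disjoint_family_on (\<lambda>t. {u t, v t, w t}) I"
          "\<forall>t\<in>I. is_path b a (- d) (u t) (v t) (w t) \<and> {u t, v t, w t} \<subseteq> {1..int n}"
        unfolding many_disjoint_paths_def by blast
      have "{w t, v t, u t} = {u t, v t, w t}" for t by auto
      then show "many_disjoint_paths \<alpha> \<beta> c K n"
        unfolding many_disjoint_paths_def scale rev
        using I by (intro exI[of _ I] exI[of _ w] exI[of _ v] exI[of _ u]) simp
    qed
  qed
qed

section \<open>Maker's win above the threshold\<close>

lemma k_distinct_solution_one_row:
  "k_distinct_solution (mat_of_rows_list 2 [[\<alpha>, -\<beta>]]) b x \<longleftrightarrow>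
    dim_vec x = 2 \<and> b = vec 1 (\<lambda>_. \<alpha> * x $ 0 - \<beta> * x $ 1) \<and> x $ 0 \<noteq> x $ 1"
proof (cases "dim_vec x = 2")
  case True
  have eq: "mat_of_rows_list 2 [[\<alpha>, -\<beta>]] *\<^sub>v x = vec 1 (\<lambda>_. \<alpha> * x $ 0 - \<beta> * x $ 1)"
    using True by (intro eq_vecI) (auto simp: mat_of_rows_list_def scalar_prod_def numeral_2_eq_2)
  have inj: "inj_on (vec_index x) {..<2} \<longleftrightarrow> x $ 0 \<noteq> x $ 1"
    by (auto simp: numeral_2_eq_2 lessThan_Suc)
  have col: "dim_col (mat_of_rows_list 2 [[\<alpha>, -\<beta>]]) = 2"
    by (simp add: mat_of_rows_list_def)
  show ?thesis
    unfolding k_distinct_solution_def col eq inj using True carrier_vecI[OF True] by blast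
next
  case False
  then show ?thesis by (auto simp: k_distinct_solution_def mat_of_rows_list_def)
qed

text \<open>Each of the two edges of the path is a solution, so the middle vertex and either end
  suffice.\<close>

lemma maker_wins_path:
  assumes "is_path \<alpha> \<beta> c u v w" "{u, v, w} \<subseteq> X"
  shows "maker_wins (mat_of_rows_list 2 [[\<alpha>, -\<beta>]]) (vec 1 (\<lambda>_. c)) X"
proof -
  have sol: "contains_solution (mat_of_rows_list 2 [[\<alpha>, -\<beta>]]) (vec 1 (\<lambda>_. c)) M"
    if "{y, z} \<subseteq> M" "\<alpha> * y - \<beta> * z = c" "y \<noteq> z" for y z M
    unfolding contains_solution_def k_distinct_solution_one_row
    using that by (intro exI[of _ "vec_of_list [y, z]"])
      (auto simp: vec_set_def numeral_2_eq_2 less_Suc_eq)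
  show ?thesis
    using assms sol
    by (intro maker_wins_through_middle[of u X v w]) (auto simp: is_path_def)
qed

lemma maker_whp:
  assumes \<alpha>\<beta>: "0 < \<alpha>" "0 < \<beta>" "\<alpha> \<noteq> \<beta>"
    and irr: "irredundant_pair (mat_of_rows_list 2 [[\<alpha>, -\<beta>]]) b"
    and p: "\<And>n. p n \<in> {0..1}" "p \<ggreater> (\<lambda>n. real n powr (-1/3))"
  shows "whp p (maker_wins (mat_of_rows_list 2 [[\<alpha>, -\<beta>]]) b)"
proof -
  let ?A = "mat_of_rows_list 2 [[\<alpha>, -\<beta>]]"
  \<comment> \<open>Irredundance supplies the solution from which the paths are built; it also fixes
    the constant \<open>c\<close>.\<close>
  obtain x where x: "k_distinct_solution ?A b x"
    using irr unfolding irredundant_pair_def by blast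
  define c where "c = \<alpha> * x $ 0 - \<beta> * x $ 1"
  have b: "b = vec 1 (\<lambda>_. c)"
    using x unfolding k_distinct_solution_one_row c_def by blast
  obtain K where K: "K > 0" "\<And>n. n \<ge> K \<Longrightarrow> many_disjoint_paths \<alpha> \<beta> c K n"
    using disjoint_paths[OF \<alpha>\<beta> c_def[symmetric]] by blast
  let ?\<epsilon> = "\<lambda>n. exp (- (1 / real K * (real n * p n ^ 3)))"
  have bound: "1 - ?\<epsilon> n \<le> measure_pmf.prob (random_set n (p n)) {X. maker_wins ?A b X}"
    if n: "n \<ge> K" for n
  proof -
    obtain I :: "int set" and u v w where I: "finite I" "n \<le> K * card I"
      and disj: "disjoint_family_on (\<lambda>t. {u t, v t, w t}) I"
      and path: "\<And>t. t \<in> I \<Longrightarrow> is_path \<alpha> \<beta> c (u t) (v t) (w t)"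
        "\<And>t. t \<in> I \<Longrightarrow> {u t, v t, w t} \<subseteq> {1..int n}"
      using K(2)[OF n] unfolding many_disjoint_paths_def by blast
    have p01: "0 \<le> p n" "p n \<le> 1" using p(1)[of n] by auto
    \<comment> \<open>By \<open>1 - t \<le> exp (- t)\<close>, all disjoint paths are missed with
      probability at most \<open>exp (- n * p ^ 3 / K)\<close>.\<close>
    have "(1 - p n ^ 3) ^ card I \<le> exp (- (p n ^ 3)) ^ card I"
      using p01 exp_ge_add_one_self[of "- (p n ^ 3)"] by (intro power_mono) (auto simp: power_le_one)
    also have "\<dots> = exp (- (real (card I) * p n ^ 3))"
      by (simp flip: exp_of_nat_mult)
    also have "\<dots> \<le> ?\<epsilon> n"
    proof -
      have "real n \<le> real K * real (card I)" using I(2) by (metis of_nat_le_iff of_nat_mult)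
      then have "real n / real K \<le> card I" using K(1) by (simp add: field_simps)
      then have "real n / real K * p n ^ 3 \<le> card I * p n ^ 3"
        using p01 by (intro mult_right_mono) auto
      then show ?thesis by simp
    qed
    finally have "1 - ?\<epsilon> n \<le> 1 - (1 - p n ^ 3) ^ card I" by simp
    also have "\<dots> = measure_pmf.prob (random_set n (p n)) {X. \<exists>t\<in>I. {u t, v t, w t} \<subseteq> X}"
      by (rule prob_random_set_contains_block[symmetric])
         (use I(1) disj path p(1) in \<open>auto simp: is_path_def\<close>)
    also have "\<dots> \<le> measure_pmf.prob (random_set n (p n)) {X. maker_wins ?A b X}"
    proof (rule measure_pmf.finite_measure_mono)
      show "{X. \<exists>t\<in>I. {u t, v t, w t} \<subseteq> X} \<subseteq> {X. maker_wins ?A b X}"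
      proof (rule subsetI, unfold mem_Collect_eq, elim bexE)
        fix X t assume "t \<in> I" "{u t, v t, w t} \<subseteq> X"
        then show "maker_wins ?A b X"
          unfolding b by (rule maker_wins_path[OF path(1)])
      qed
    qed simp
    finally show ?thesis .
  qed
  have "filterlim (\<lambda>n. real n * p n ^ 3) at_top sequentially"
    using filterlim_pow_at_top[OF _ p(2)[unfolded much_greater_def], of 3]
    by (simp only: cube_div_powr zero_less_numeral)
  then have "filterlim (\<lambda>n. 1 / real K * (real n * p n ^ 3)) at_top sequentially"
    using K(1) by (intro filterlim_tendsto_pos_mult_at_top[OF tendsto_const]) auto
  then have "?\<epsilon> \<longlonglongrightarrow> 0"
    by (intro filterlim_compose[OF exp_at_bot]) (simp add: filterlim_uminus_at_bot)
  then show ?thesis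
    using bound by (intro whpI[where \<epsilon> = ?\<epsilon>]) (auto simp: eventually_sequentially)
qed

theorem theorem4p1:
  fixes A :: "int mat" and b :: "int Matrix.vec" and l k :: nat
  assumes "A \<in> carrier_mat l k"
    and "b \<in> carrier_vec l"
    and "irredundant_pair A b"
    and "irredundant A"
    and "\<not> satisfies_star A"
  shows
    "(\<forall>(\<alpha>::int) (\<beta>::int). \<alpha> > 0 \<and> \<beta> > 0 \<and> \<alpha> \<noteq> \<beta> \<and>
        A = mat_of_rows_list 2 [[\<alpha>, -\<beta>]] \<longrightarrow>
        (\<forall>p :: nat \<Rightarrow> real. (\<forall>n. p n \<in> {0..1}) \<and> p \<ggreater> (\<lambda>n. real n powr (-1/3)) \<longrightarrow>
           whp p (maker_wins A b)))
     \<and> (\<forall>p :: nat \<Rightarrow> real. (\<forall>n. p n \<in> {0..1}) \<and> p \<lless> (\<lambda>n. real n powr (-1/3)) \<longrightarrow>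
           whp p (breaker_wins A b))
     \<and> (\<forall>(\<alpha>::int) (\<beta>::int). \<alpha> > 0 \<and> \<beta> > 0 \<and> \<alpha> \<noteq> \<beta> \<and>
        A = mat_of_rows_list 3 [[\<alpha>, -\<beta>, 0], [0, \<alpha>, -\<beta>]] \<longrightarrow>
        (\<forall>n. breaker_wins A (0\<^sub>v l) {1..int n}) \<and>
        (\<forall>n (q::real). 0 < q \<and> q < 1 \<longrightarrow>
           measure_pmf.prob (random_set n q) {X. breaker_wins A (0\<^sub>v l) X} = 1))"
proof (intro conjI allI impI)
  fix \<alpha> \<beta> :: int and p :: "nat \<Rightarrow> real"
  assume "\<alpha> > 0 \<and> \<beta> > 0 \<and> \<alpha> \<noteq> \<beta> \<and> A = mat_of_rows_list 2 [[\<alpha>, -\<beta>]]"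
    and "(\<forall>n. p n \<in> {0..1}) \<and> p \<ggreater> (\<lambda>n. real n powr (-1/3))"
  then show "whp p (maker_wins A b)"
    using maker_whp[of \<alpha> \<beta> b p] assms(3) by blast
next
  fix p :: "nat \<Rightarrow> real"
  assume "(\<forall>n. p n \<in> {0..1}) \<and> p \<lless> (\<lambda>n. real n powr (-1/3))"
  then show "whp p (breaker_wins A b)"
    using breaker_whp[OF assms(1,5), of p b] by blast
next
  fix \<alpha> \<beta> :: int
  assume eq: "\<alpha> > 0 \<and> \<beta> > 0 \<and> \<alpha> \<noteq> \<beta> \<and> A = mat_of_rows_list 3 [[\<alpha>, -\<beta>, 0], [0, \<alpha>, -\<beta>]]"
  then have "l = 2" using assms(1) by (auto simp: mat_of_rows_list_def)
  then have breaker: "breaker_wins A (0\<^sub>v l) X" if "X \<subseteq> {1..}" for X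
    using eq that breaker_wins_geometric by blast
  show "breaker_wins A (0\<^sub>v l) {1..int n}" for n
    by (rule breaker) auto
  show "measure_pmf.prob (random_set n q) {X. breaker_wins A (0\<^sub>v l) X} = 1" for n q
  proof -
    \<comment> \<open>Breaker wins on every set in the support, so the event is almost sure.\<close>
    have "breaker_wins A (0\<^sub>v l) X" if "X \<in> set_pmf (random_set n q)" for X
      using set_random_set[OF that] by (intro breaker) auto
    then have "AE X in random_set n q. X \<in> {X. breaker_wins A (0\<^sub>v l) X}"
      by (simp add: AE_measure_pmf_iff)
    then show ?thesis by (simp add: measure_pmf.prob_eq_1)
  qed
qed

end
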